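(* Let $\alpha>0$, let $\mathcal{M}=\{\boldsymbol{u}\in\mathbb{R}^{m(N+1)} : G(\boldsymbol{u})=0\}$, and let $$\phi(\boldsymbol{u})=\boldsymbol{u}-\Sigma G'(\boldsymbol{u})^T\left(G'(\boldsymbol{u})\Sigma G'(\boldsymbol{u})^T+\alpha Q\right)^{-1}G(\boldsymbol{u}),\qquad \Omega(\boldsymbol{u})=G'(\boldsymbol{u})^TQ^{-1}G'(\boldsymbol{u}),$$ with $G$, $\Sigma$, $Q$ as in the context. Suppose that for every $\boldsymbol{u}\in\mathcal{M}$ the matrices $\Sigma$ and $\Omega(\boldsymbol{u})$ commute and $$\alpha>\tfrac12\,\lambda_{\max}\left(\Sigma\,\Omega(\boldsymbol{u})|_{\mathcal{N}_{\boldsymbol{u}}\mathcal{M}}\right)-\lambda_{\min}\left(\Sigma\,\Omega(\boldsymbol{u})|_{\mathcal{N}_{\boldsymbol{u}}\mathcal{M}}\right).$$ Then $\left\|D\phi(\boldsymbol{u})|_{\mathcal{N}_{\boldsymbol{u}}\mathcal{M}}\right\|<1$ for all $\boldsymbol{u}\in\mathcal{M}$.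
   Context: Let $m,d,N$ be positive integers with $d\le m$. For $n=0,\dots,N-1$ let $F_n:\mathbb{R}^m\to\mathbb{R}^m$ be $\mathcal{C}^3$. For $\boldsymbol{u}=(u_0,\dots,u_N)\in(\mathbb{R}^m)^{N+1}=\mathbb{R}^{m(N+1)}$ define $G(\boldsymbol{u})=(G_0(\boldsymbol{u}),\dots,G_{N-1}(\boldsymbol{u}))\in\mathbb{R}^{mN}$ by $G_n(\boldsymbol{u})=u_{n+1}-F_n(u_n)$, and let $G'(\boldsymbol{u})$ be its Jacobian, i.e. the $mN\times m(N+1)$ block matrix whose $n$-th block row ($n=0,\dots,N-1$) has $-F_n'(u_n)$ in block column $n$, the identity $I$ in block column $n+1$, and zeros elsewhere. Matrices: $H=\mathrm{blockdiag}(H_0,\dots,H_N)$ with $H_n\in\mathbb{R}^{d\times m}$ (linear observation operators); $R=\mathrm{blockdiag}(R_0,\dots,R_N)$ with $R_n\in\mathbb{R}^{d\times d}$ symmetric positive definite (observational error covariances); $W=\mathrm{blockdiag}(W_0,\dots,W_N)$ with $W_n\in\mathbb{R}^{m\times m}$ symmetric positive definite; $Q=\mathrm{blockdiag}(Q_1,\dots,Q_N)$ with $Q_n\in\mathbb{R}^{m\times m}$ symmetric positive definite. The matrix $\Sigma$ is $$\Sigma=H^TRH+(I-H^TH)W(I-H^TH).$$ The set $\mathcal{M}$ is a smooth manifold in $\mathbb{R}^{m(N+1)}$. For $\boldsymbol{u}\in\mathcal{M}$, $\mathcal{T}_{\boldsymbol{u}}\mathcal{M}=\ker G'(\boldsymbol{u})$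 is its tangent space and $\mathcal{N}_{\boldsymbol{u}}\mathcal{M}=(\mathcal{T}_{\boldsymbol{u}}\mathcal{M})^{\perp}$ its normal space (Euclidean orthogonal complement). When $\Sigma$ and $\Omega(\boldsymbol{u})$ commute, $\Sigma\Omega(\boldsymbol{u})$ is symmetric and maps $\mathcal{N}_{\boldsymbol{u}}\mathcal{M}$ to itself; $\lambda_{\max}$ and $\lambda_{\min}$ denote the largest and smallest eigenvalue of the restriction. $D\phi(\boldsymbol{u})$ is the derivative of $\phi$ at $\boldsymbol{u}$, the vertical bar denotes restriction to a subspace, and $\|\cdot\|$ is the operator norm induced by the Euclidean norm. *)

theory Defs
  imports "HOL-Analysis.Analysis"
begin

text \<open>
  The number \<open>N\<close> of time steps is \<open>CARD('n)\<close> for a type variable \<open>'n\<close>, and \<open>m = CARD('m)\<close>,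
  \<open>d = CARD('d)\<close>. The type \<open>'k idx\<close> is the set \<open>{0, \<dots>, CARD('k) - 1}\<close> of naturals, so that
  \<open>'n idx\<close> is \<open>{0, \<dots>, N - 1}\<close> and \<open>'n option idx\<close> is \<open>{0, \<dots>, N}\<close>. Block vectors and block
  matrices are flattened: \<open>real ^ ('k idx \<times> 'm)\<close> is Euclidean space of dimension
  \<open>CARD('k) * CARD('m)\<close>, the pair \<open>(n, i)\<close> indexing entry \<open>i\<close> of block \<open>n\<close>.
\<close>

typedef 'k idx = "{..<CARD('k::finite)}"
  morphisms idx_nat nat_idx
  by (rule exI[of _ 0]) simp

instance idx :: (finite) finite
proof
  show "finite (UNIV :: 'a idx set)"
    using type_definition.univ[OF type_definition_idx] by (metis finite_imageI finite_lessThan)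
qed

lemma card_idx [simp]: "CARD('k::finite idx) = CARD('k)"
  using type_definition.card[OF type_definition_idx] by simp

type_synonym ('n, 'm) traj = "real ^ ('n option idx \<times> 'm)"
type_synonym ('n, 'm) defect = "real ^ ('n idx \<times> 'm)"

definition block :: "real ^ ('k::finite idx \<times> 'm::finite) \<Rightarrow> nat \<Rightarrow> real ^ 'm" where
  "block u n = (\<chi> i. u $ (nat_idx n, i))"

text \<open>\<open>blockdiag A\<close> has the diagonal blocks \<open>A 0, \<dots>, A (CARD('k) - 1)\<close>; other \<open>A n\<close> are ignored.\<close>

definition blockdiag ::
  "(nat \<Rightarrow> real ^ 'b ^ 'a) \<Rightarrow> real ^ ('k::finite idx \<times> 'b::finite) ^ ('k idx \<times> 'a::finite)" where
  "blockdiag A =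
     (\<chi> p q. if fst p = fst q then A (idx_nat (fst p)) $ snd p $ snd q else 0)"

definition sym_pos_def :: "real ^ 'a ^ 'a::finite \<Rightarrow> bool" where
  "sym_pos_def A \<longleftrightarrow> transpose A = A \<and> (\<forall>x. x \<noteq> 0 \<longrightarrow> x \<bullet> (A *v x) > 0)"

definition C3 :: "('a::real_normed_vector \<Rightarrow> 'b::real_normed_vector) \<Rightarrow> bool" where
  "C3 f \<longleftrightarrow>
     (\<exists>(f1 :: 'a \<Rightarrow> 'a \<Rightarrow>\<^sub>L 'b) (f2 :: 'a \<Rightarrow> 'a \<Rightarrow>\<^sub>L 'a \<Rightarrow>\<^sub>L 'b) (f3 :: 'a \<Rightarrow> 'a \<Rightarrow>\<^sub>L 'a \<Rightarrow>\<^sub>L 'a \<Rightarrow>\<^sub>L 'b).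
        (\<forall>x. (f has_derivative blinfun_apply (f1 x)) (at x)) \<and>
        (\<forall>x. (f1 has_derivative blinfun_apply (f2 x)) (at x)) \<and>
        (\<forall>x. (f2 has_derivative blinfun_apply (f3 x)) (at x)) \<and>
        continuous_on UNIV f3)"

definition G_map ::
  "(nat \<Rightarrow> real ^ 'm \<Rightarrow> real ^ 'm) \<Rightarrow> ('n::finite, 'm::finite) traj \<Rightarrow> ('n, 'm) defect" where
  "G_map F u = (\<chi> p. let n = idx_nat (fst p) in (block u (Suc n) - F n (block u n)) $ snd p)"

definition G_jac ::
  "(nat \<Rightarrow> real ^ 'm \<Rightarrow> real ^ 'm) \<Rightarrow> ('n, 'm) traj \<Rightarrow>
     real ^ ('n::finite option idx \<times> 'm::finite) ^ ('n idx \<times> 'm)" where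
  "G_jac F u = jacobian (G_map F) (at u)"

definition Sigma_mat ::
  "(nat \<Rightarrow> real ^ 'm ^ 'd) \<Rightarrow> (nat \<Rightarrow> real ^ 'd ^ 'd) \<Rightarrow> (nat \<Rightarrow> real ^ 'm ^ 'm) \<Rightarrow>
     real ^ ('k::finite idx \<times> 'm::finite) ^ ('k idx \<times> 'm)" where
  "Sigma_mat Hs Rs Ws =
     (let H = (blockdiag Hs :: real ^ ('k idx \<times> 'm) ^ ('k idx \<times> 'd::finite));
          R = blockdiag Rs;
          W = blockdiag Ws
      in transpose H ** R ** H + (mat 1 - transpose H ** H) ** W ** (mat 1 - transpose H ** H))"

text \<open>The given matrices are \<open>Q\<^sub>1, \<dots>, Q\<^sub>N\<close>; block row \<open>n\<close> (counted from \<open>0\<close>) of \<open>Q\<close> is \<open>Q\<^sub>n\<^sub>+\<^sub>1\<close>.\<close>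

definition Q_mat ::
  "(nat \<Rightarrow> real ^ 'm ^ 'm) \<Rightarrow> real ^ ('n::finite idx \<times> 'm::finite) ^ ('n idx \<times> 'm)" where
  "Q_mat Qs = blockdiag (\<lambda>n. Qs (Suc n))"

definition Omega_mat ::
  "(nat \<Rightarrow> real ^ 'm \<Rightarrow> real ^ 'm) \<Rightarrow> (nat \<Rightarrow> real ^ 'm ^ 'm) \<Rightarrow> ('n, 'm) traj \<Rightarrow>
     real ^ ('n::finite option idx \<times> 'm::finite) ^ ('n option idx \<times> 'm)" where
  "Omega_mat F Qs u = transpose (G_jac F u) ** matrix_inv (Q_mat Qs) ** G_jac F u"

definition phi_map ::
  "(nat \<Rightarrow> real ^ 'm \<Rightarrow> real ^ 'm) \<Rightarrow> (nat \<Rightarrow> real ^ 'm ^ 'd) \<Rightarrow> (nat \<Rightarrow> real ^ 'd ^ 'd) \<Rightarrow>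
     (nat \<Rightarrow> real ^ 'm ^ 'm) \<Rightarrow> (nat \<Rightarrow> real ^ 'm ^ 'm) \<Rightarrow> real \<Rightarrow>
     ('n::finite, 'm::finite) traj \<Rightarrow> ('n, 'm) traj" where
  "phi_map F Hs Rs Ws Qs \<alpha> u =
     (let G' = G_jac F u; S = Sigma_mat Hs Rs (Ws :: nat \<Rightarrow> real ^ 'm ^ 'm)
      in u - (S ** transpose G'
                ** matrix_inv (G' ** S ** transpose G' + \<alpha> *\<^sub>R Q_mat Qs)) *v G_map F u)"

definition zero_set :: "(nat \<Rightarrow> real ^ 'm \<Rightarrow> real ^ 'm) \<Rightarrow> ('n::finite, 'm::finite) traj set" where
  "zero_set F = {u. G_map F u = 0}"

definition tangent_space_at ::
  "(nat \<Rightarrow> real ^ 'm \<Rightarrow> real ^ 'm) \<Rightarrow> ('n::finite, 'm::finite) traj \<Rightarrow> ('n, 'm) traj set" where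
  "tangent_space_at F u = {v. G_jac F u *v v = 0}"

definition normal_space_at ::
  "(nat \<Rightarrow> real ^ 'm \<Rightarrow> real ^ 'm) \<Rightarrow> ('n::finite, 'm::finite) traj \<Rightarrow> ('n, 'm) traj set" where
  "normal_space_at F u = orthogonal_comp (tangent_space_at F u)"

text \<open>
  For a subspace \<open>S\<close> that \<open>A\<close> maps to itself, \<open>eigenvalues_on S A\<close> is the set of real eigenvalues of
  the restriction of \<open>A\<close> to \<open>S\<close>.
\<close>

definition eigenvalues_on :: "(real ^ 'a) set \<Rightarrow> real ^ 'a ^ 'a::finite \<Rightarrow> real set" where
  "eigenvalues_on S A = {\<mu>. \<exists>v\<in>S. v \<noteq> 0 \<and> A *v v = \<mu> *\<^sub>R v}"

definition lambda_max :: "(real ^ 'a) set \<Rightarrow> real ^ 'a ^ 'a::finite \<Rightarrow> real" where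
  "lambda_max S A = Max (eigenvalues_on S A)"

definition lambda_min :: "(real ^ 'a) set \<Rightarrow> real ^ 'a ^ 'a::finite \<Rightarrow> real" where
  "lambda_min S A = Min (eigenvalues_on S A)"

text \<open>Like \<^const>\<open>onorm\<close>, with the supremum over \<open>S\<close>; \<open>x = 0\<close> contributes \<open>0 / 0 = 0\<close>.\<close>

definition onorm_on ::
  "'a::real_normed_vector set \<Rightarrow> ('a \<Rightarrow> 'b::real_normed_vector) \<Rightarrow> real" where
  "onorm_on S f = (SUP x\<in>S. norm (f x) / norm x)"

end

theory Submission
  imports Defs
begin

text \<open>
  On \<open>\<M>\<close> the term containing the derivative of \<open>\<Sigma> G'\<^sup>T (G' \<Sigma> G'\<^sup>T + \<alpha> Q)\<^sup>-\<^sup>1\<close> is multiplied by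
  \<open>G(u) = 0\<close>, so \<open>w = D\<phi>(u) v\<close> is \<open>v - \<Sigma> G'\<^sup>T (G' \<Sigma> G'\<^sup>T + \<alpha> Q)\<^sup>-\<^sup>1 G' v\<close>, and it
  satisfies \<open>(\<Sigma> \<Omega> + \<alpha>) w = \<alpha> v\<close>. The operator \<open>\<Sigma> \<Omega>\<close> is symmetric and its eigenvalues on the
  normal space are positive: from \<open>\<Sigma> \<Omega> x = \<mu> x\<close> one gets \<open>x \<bullet> \<Omega> x = \<mu> (x \<bullet> \<Sigma>\<^sup>-\<^sup>1 x)\<close>. If
  \<open>c > 0\<close> bounds its Rayleigh quotient on the normal space from below, then
  \<open>\<parallel>w\<parallel> \<le> \<alpha> / (\<alpha> + c) \<parallel>v\<parallel>\<close>.
\<close>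

text \<open>As a simp rule this equation turns \<open>transpose A *v x\<close> into
  \<open>x v* A\<close>. Products with a transpose are kept in the first form, so that they
  reassociate with the other factors.\<close>

declare transpose_matrix_vector [simp del]

subsection \<open>Inverses of matrices\<close>

lemma matrix_inv_right:
  fixes A :: "'a::semiring_1 ^ 'n ^ 'm"
  assumes "invertible A"
  shows "A ** matrix_inv A = mat 1"
  using someI_ex[OF assms[unfolded invertible_def]] unfolding matrix_inv_def by blast

lemma matrix_inv_left:
  fixes A :: "'a::semiring_1 ^ 'n ^ 'm"
  assumes "invertible A"
  shows "matrix_inv A ** A = mat 1"
  using someI_ex[OF assms[unfolded invertible_def]] unfolding matrix_inv_def by blast

lemma matrix_vector_mult_matrix_inv:
  fixes A :: "real ^ 'n ^ 'n"
  assumes "invertible A"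
  shows "A *v (matrix_inv A *v x) = x"
  by (simp add: matrix_vector_mul_assoc matrix_inv_right[OF assms])

lemma matrix_inv_matrix_vector_mult:
  fixes A :: "real ^ 'n ^ 'n"
  assumes "invertible A"
  shows "matrix_inv A *v (A *v x) = x"
  by (simp add: matrix_vector_mul_assoc matrix_inv_left[OF assms])

lemma transpose_matrix_inv:
  fixes A :: "real ^ 'n ^ 'n"
  assumes "invertible A"
  shows "transpose (matrix_inv A) = matrix_inv (transpose A)"
proof -
  have inv: "invertible (transpose A)"
    using assms by (rule transpose_invertible)
  have "transpose (matrix_inv A) ** transpose A = mat 1"
    by (simp add: matrix_transpose_mul[symmetric] matrix_inv_right[OF assms] transpose_mat)
  then have "transpose (matrix_inv A) ** (transpose A ** matrix_inv (transpose A))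
      = matrix_inv (transpose A)"
    by (simp add: matrix_mul_assoc)
  then show ?thesis
    by (simp add: matrix_inv_right[OF inv])
qed

text \<open>Cramer's rule for the system with right-hand side \<open>axis j 1\<close>. It makes each
  entry of the inverse a quotient of determinants, so continuity of inversion reduces to continuity
  of \<open>det\<close>.\<close>

lemma matrix_inv_component:
  fixes A :: "real ^ 'n ^ 'n"
  assumes "det A \<noteq> 0"
  shows "matrix_inv A $ k $ j = det (\<chi> i l. if l = k then axis j 1 $ i else A $ i $ l) / det A"
proof -
  have inv: "invertible A"
    using assms by (simp add: invertible_det_nz)
  have "A *v (matrix_inv A *v axis j 1) = axis j 1"
    by (rule matrix_vector_mult_matrix_inv[OF inv])
  then have "(matrix_inv A *v axis j 1) $ k
      = det (\<chi> i l. if l = k then axis j 1 $ i else A $ i $ l) / det A"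
    by (simp only: cramer[OF assms] vec_lambda_beta)
  then show ?thesis
    by (simp add: matrix_vector_mult_basis column_def)
qed

lemma tendsto_det:
  fixes f :: "'a \<Rightarrow> real ^ 'n ^ 'n"
  assumes "(f \<longlongrightarrow> A) net"
  shows "((\<lambda>x. det (f x)) \<longlongrightarrow> det A) net"
  unfolding det_def
  by (intro tendsto_sum tendsto_mult tendsto_prod tendsto_const tendsto_vec_nth assms)

lemma tendsto_matrix_inv:
  fixes f :: "'a \<Rightarrow> real ^ 'n ^ 'n"
  assumes f: "(f \<longlongrightarrow> A) net" and A: "invertible A"
  shows "((\<lambda>x. matrix_inv (f x)) \<longlongrightarrow> matrix_inv A) net"
proof (intro vec_tendstoI)
  fix k j
  have nz: "det A \<noteq> 0"
    using A by (simp add: invertible_det_nz)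
  \<comment> \<open>Invertibility is assumed at the limit only. Nonvanishing of the determinant
    passes to nearby values, where the quotient formula then describes the inverse.\<close>
  have ev: "\<forall>\<^sub>F x in net. det (f x) \<noteq> 0"
    using tendsto_imp_eventually_ne[OF tendsto_det[OF f] nz] .
  have "((\<lambda>x. det (\<chi> i l. if l = k then axis j 1 $ i else f x $ i $ l))
      \<longlongrightarrow> det (\<chi> i l. if l = k then axis j 1 $ i else A $ i $ l)) net"
  proof (rule tendsto_det, intro tendsto_vec_lambda)
    fix i l
    show "((\<lambda>x. if l = k then axis j 1 $ i else f x $ i $ l)
        \<longlongrightarrow> (if l = k then axis j 1 $ i else A $ i $ l)) net"
      by (cases "l = k") (simp_all add: tendsto_vec_nth[OF tendsto_vec_nth[OF f]])
  qed
  then have "((\<lambda>x. det (\<chi> i l. if l = k then axis j 1 $ i else f x $ i $ l) / det (f x))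
      \<longlongrightarrow> matrix_inv A $ k $ j) net"
    unfolding matrix_inv_component[OF nz] by (rule tendsto_divide[OF _ tendsto_det[OF f] nz])
  then show "((\<lambda>x. matrix_inv (f x) $ k $ j) \<longlongrightarrow> matrix_inv A $ k $ j) net"
    by (rule Lim_transform_eventually)
      (use ev in eventually_elim, simp add: matrix_inv_component)
qed

lemma tendsto_matrix_mult:
  fixes f :: "'a \<Rightarrow> real ^ 'n ^ 'm" and g :: "'a \<Rightarrow> real ^ 'p ^ 'n"
  assumes "(f \<longlongrightarrow> A) net" "(g \<longlongrightarrow> B) net"
  shows "((\<lambda>x. f x ** g x) \<longlongrightarrow> A ** B) net"
  unfolding matrix_matrix_mult_def
  by (intro tendsto_vec_lambda tendsto_sum tendsto_mult tendsto_vec_nth assms)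

lemma tendsto_transpose:
  fixes f :: "'a \<Rightarrow> real ^ 'n ^ 'm"
  assumes "(f \<longlongrightarrow> A) net"
  shows "((\<lambda>x. transpose (f x)) \<longlongrightarrow> transpose A) net"
  unfolding transpose_def by (intro tendsto_vec_lambda tendsto_vec_nth assms)

subsection \<open>Positive definite matrices\<close>

lemma inner_transpose_mult:
  fixes A :: "real ^ 'n ^ 'm"
  shows "x \<bullet> (transpose A *v y) = (A *v x) \<bullet> y"
  by (metis dot_lmul_matrix inner_commute transpose_matrix_vector)

lemma transpose_add: "transpose (A + B) = transpose A + transpose B"
  by (simp add: transpose_def vec_eq_iff)

lemma transpose_diff: "transpose (A - B) = transpose A - transpose B"
  by (simp add: transpose_def vec_eq_iff)

lemma sym_pos_def_symmetric: "sym_pos_def A \<Longrightarrow> transpose A = A"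
  by (simp add: sym_pos_def_def)

lemma sym_pos_def_pos: "sym_pos_def A \<Longrightarrow> x \<noteq> 0 \<Longrightarrow> x \<bullet> (A *v x) > 0"
  by (simp add: sym_pos_def_def)

lemma sym_pos_def_nonneg: "sym_pos_def A \<Longrightarrow> x \<bullet> (A *v x) \<ge> 0"
  by (cases "x = 0") (auto dest: sym_pos_def_pos[of A x])

lemma sym_pos_def_invertible:
  assumes "sym_pos_def A"
  shows "invertible A"
proof -
  have "x = 0" if "A *v x = 0" for x
    using sym_pos_def_pos[OF assms, of x] that by auto
  then show ?thesis
    by (metis invertible_left_inverse matrix_left_invertible_ker)
qed

lemma sym_pos_def_matrix_inv:
  assumes A: "sym_pos_def A"
  shows "sym_pos_def (matrix_inv A)"
  unfolding sym_pos_def_def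
proof (intro conjI allI impI)
  note inv = sym_pos_def_invertible[OF A]
  show "transpose (matrix_inv A) = matrix_inv A"
    by (simp add: transpose_matrix_inv[OF inv] sym_pos_def_symmetric[OF A])
  fix x :: "real ^ 'a"
  assume "x \<noteq> 0"
  \<comment> \<open>With \<open>y = matrix_inv A *v x\<close> the quadratic form of the inverse at
    \<open>x\<close> is that of \<open>A\<close> at \<open>y\<close>.\<close>
  then have "matrix_inv A *v x \<noteq> 0"
    by (metis matrix_vector_mult_matrix_inv[OF inv] matrix_vector_mult_0_right)
  from sym_pos_def_pos[OF A this] show "x \<bullet> (matrix_inv A *v x) > 0"
    by (simp add: matrix_vector_mult_matrix_inv[OF inv] inner_commute)
qed

text \<open>The congruence term is only nonnegative, as \<open>transpose J\<close> may have a
  kernel; \<open>\<alpha> *\<^sub>R Q\<close> makes the sum strictly positive. Hence the matrix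
  inverted in the update is invertible for every \<open>J\<close>.\<close>

lemma sym_pos_def_congruence_add:
  fixes J :: "real ^ 'a ^ 'b"
  assumes S: "sym_pos_def S" and Q: "sym_pos_def Q" and "\<alpha> > 0"
  shows "sym_pos_def (J ** S ** transpose J + \<alpha> *\<^sub>R Q)"
  unfolding sym_pos_def_def
proof (intro conjI allI impI)
  show "transpose (J ** S ** transpose J + \<alpha> *\<^sub>R Q) = J ** S ** transpose J + \<alpha> *\<^sub>R Q"
    by (simp add: transpose_add matrix_transpose_mul transpose_transpose transpose_scalar
        sym_pos_def_symmetric[OF S] sym_pos_def_symmetric[OF Q] matrix_mul_assoc)
  fix x :: "real ^ 'b"
  assume "x \<noteq> 0"
  have "x \<bullet> (J ** S ** transpose J *v x) = (transpose J *v x) \<bullet> (S *v (transpose J *v x))"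
    using inner_transpose_mult[of x "transpose J" "S *v (transpose J *v x)"]
    by (simp add: matrix_vector_mul_assoc matrix_mul_assoc)
  then have "x \<bullet> (J ** S ** transpose J *v x) \<ge> 0"
    using sym_pos_def_nonneg[OF S] by simp
  moreover have "\<alpha> * (x \<bullet> (Q *v x)) > 0"
    using \<open>\<alpha> > 0\<close> sym_pos_def_pos[OF Q \<open>x \<noteq> 0\<close>] by simp
  ultimately show "x \<bullet> ((J ** S ** transpose J + \<alpha> *\<^sub>R Q) *v x) > 0"
    by (simp add: matrix_vector_mult_add_rdistrib inner_add_right scaleR_matrix_vector_assoc[symmetric])
qed

section \<open>Block diagonal matrices and positive definiteness of \<Sigma>\<close>

lemma blockdiag_mult_nth:
  fixes x :: "real ^ ('k::finite idx \<times> 'b::finite)" and A :: "nat \<Rightarrow> real ^ 'b ^ 'a::finite"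
  shows "(blockdiag A *v x) $ (n, i) = (A (idx_nat n) *v (\<chi> j. x $ (n, j))) $ i"
proof -
  have "(blockdiag A *v x) $ (n, i)
      = (\<Sum>k\<in>UNIV. \<Sum>j\<in>UNIV. if n = k then A (idx_nat n) $ i $ j * x $ (k, j) else 0)"
    by (simp add: matrix_vector_mult_def blockdiag_def UNIV_Times_UNIV[symmetric]
        sum.cartesian_product case_prod_beta if_distrib[of "\<lambda>t. t * _"] cong: if_cong del: UNIV_Times_UNIV)
  also have "\<dots> = (\<Sum>k\<in>UNIV. if n = k then \<Sum>j\<in>UNIV. A (idx_nat n) $ i $ j * x $ (k, j) else 0)"
    by (intro sum.cong) auto
  finally show ?thesis
    by (simp add: matrix_vector_mult_def)
qed

lemma sym_pos_def_blockdiag: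
  fixes A :: "nat \<Rightarrow> real ^ 'a ^ 'a::finite"
  assumes A: "\<And>n. n < CARD('k::finite) \<Longrightarrow> sym_pos_def (A n)"
  shows "sym_pos_def (blockdiag A :: real ^ ('k idx \<times> 'a) ^ ('k idx \<times> 'a))"
proof -
  have spd: "sym_pos_def (A (idx_nat k))" for k :: "'k idx"
    using A idx_nat[of k] by simp
  have sym: "A (idx_nat k) $ i $ j = A (idx_nat k) $ j $ i" for k :: "'k idx" and i j
    using arg_cong[OF sym_pos_def_symmetric[OF spd[of k]], of "\<lambda>M. M $ j $ i"]
    by (simp add: transpose_def)
  have "x \<bullet> (blockdiag A *v x) > 0" if "x \<noteq> 0" for x :: "real ^ ('k idx \<times> 'a)"
  proof -
    define y where "y k = (\<chi> j. x $ (k, j))" for k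
    \<comment> \<open>The form decouples into the forms of the blocks, all nonnegative; a nonzero
      \<open>x\<close> has a nonzero block, whose term is strictly positive.\<close>
    have eq: "x \<bullet> (blockdiag A *v x) = (\<Sum>k\<in>UNIV. y k \<bullet> (A (idx_nat k) *v y k))"
      unfolding inner_vec_def y_def
      by (subst sum.cartesian_product) (auto intro!: sum.cong simp: blockdiag_mult_nth)
    obtain k i where "x $ (k, i) \<noteq> 0"
      using \<open>x \<noteq> 0\<close> by (auto simp: vec_eq_iff)
    then have "y k \<noteq> 0"
      by (auto simp: y_def vec_eq_iff)
    then show ?thesis
      unfolding eq using sym_pos_def_nonneg[OF spd] sym_pos_def_pos[OF spd]
      by (intro sum_pos2[of UNIV k]) auto
  qed
  moreover have "transpose (blockdiag A) = (blockdiag A :: real ^ ('k idx \<times> 'a) ^ ('k idx \<times> 'a))"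
    by (auto simp: transpose_def blockdiag_def vec_eq_iff sym)
  ultimately show ?thesis
    by (simp add: sym_pos_def_def)
qed

text \<open>With P = I - H^T H, which is symmetric, the quadratic form is the R-form at Hx plus the
  W-form at Px. Both are nonnegative. If Hx = 0, then Px = x, so they cannot both vanish at a
  nonzero x.\<close>

lemma sym_pos_def_Sigma_mat:
  fixes H :: "nat \<Rightarrow> real ^ 'm ^ 'd::finite"
  assumes "\<And>n. n < CARD('k::finite) \<Longrightarrow> sym_pos_def (R n)"
    and "\<And>n. n < CARD('k) \<Longrightarrow> sym_pos_def (W n)"
  shows "sym_pos_def (Sigma_mat H R W :: real ^ ('k idx \<times> 'm::finite) ^ ('k idx \<times> 'm))"
proof -
  let ?H = "blockdiag H :: real ^ ('k idx \<times> 'm) ^ ('k idx \<times> 'd)"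
  let ?P = "mat 1 - transpose ?H ** ?H"
  let ?R = "blockdiag R :: real ^ ('k idx \<times> 'd) ^ ('k idx \<times> 'd)"
  let ?W = "blockdiag W :: real ^ ('k idx \<times> 'm) ^ ('k idx \<times> 'm)"
  have R: "sym_pos_def ?R" and W: "sym_pos_def ?W"
    using assms by (auto intro!: sym_pos_def_blockdiag)
  have tP: "transpose ?P = ?P"
    by (simp add: transpose_diff transpose_mat matrix_transpose_mul transpose_transpose)
  have Sigma: "Sigma_mat H R W = transpose ?H ** ?R ** ?H + ?P ** ?W ** ?P"
    by (simp add: Sigma_mat_def Let_def)
  have "x \<bullet> (Sigma_mat H R W *v x) > 0" if "x \<noteq> 0" for x :: "real ^ ('k idx \<times> 'm)"
  proof -
    have "x \<bullet> (Sigma_mat H R W *v x)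
        = (?H *v x) \<bullet> (?R *v (?H *v x)) + (?P *v x) \<bullet> (?W *v (?P *v x))"
      using inner_transpose_mult[of x ?H "?R *v (?H *v x)"]
        inner_transpose_mult[of x ?P "?W *v (?P *v x)"]
      by (simp add: Sigma tP matrix_vector_mult_add_rdistrib inner_add_right
          matrix_vector_mul_assoc matrix_mul_assoc)
    moreover have "?P *v x \<noteq> 0" if "?H *v x = 0"
      using that \<open>x \<noteq> 0\<close> by (simp add: matrix_vector_mult_diff_rdistrib matrix_vector_mul_assoc[symmetric])
    ultimately show ?thesis
      using sym_pos_def_pos[OF R, of "?H *v x"] sym_pos_def_pos[OF W, of "?P *v x"]
        sym_pos_def_nonneg[OF R, of "?H *v x"] sym_pos_def_nonneg[OF W, of "?P *v x"]
      by (cases "?H *v x = 0") auto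
  qed
  moreover have "transpose (Sigma_mat H R W) = (Sigma_mat H R W :: real ^ ('k idx \<times> 'm) ^ ('k idx \<times> 'm))"
    by (simp add: Sigma transpose_add matrix_transpose_mul transpose_transpose tP matrix_mul_assoc
        sym_pos_def_symmetric[OF R] sym_pos_def_symmetric[OF W])
  ultimately show ?thesis
    by (simp add: sym_pos_def_def)
qed

subsection \<open>The Rayleigh quotient on an invariant subspace\<close>

text \<open>By compactness the Rayleigh quotient attains its minimum on the unit sphere of
  \<open>S\<close>; the minimum is an eigenvalue because the residual at a minimizer is itself an
  admissible direction of variation.\<close>

lemma symmetric_min_eigenvalue_on:
  fixes A :: "real ^ 'a ^ 'a::finite"
  assumes sym: "transpose A = A" and S: "subspace S" and inv: "\<And>x. x \<in> S \<Longrightarrow> A *v x \<in> S"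
    and "S \<noteq> {0}"
  obtains c where "c \<in> eigenvalues_on S A" "\<And>x. x \<in> S \<Longrightarrow> c * (x \<bullet> x) \<le> x \<bullet> (A *v x)"
proof -
  let ?K = "S \<inter> sphere 0 1"
  obtain y where y: "y \<in> S" "y \<noteq> 0"
    using \<open>S \<noteq> {0}\<close> S subspace_0 by fastforce
  then have "y /\<^sub>R norm y \<in> ?K"
    using S by (simp add: subspace_scale)
  then have "?K \<noteq> {}"
    by blast
  moreover have "compact ?K"
    by (intro closed_Int_compact closed_subspace S) simp
  moreover have "continuous_on ?K (\<lambda>x. x \<bullet> (A *v x))"
    by (intro continuous_intros)
  ultimately obtain v where v: "v \<in> ?K" and vmin: "\<And>x. x \<in> ?K \<Longrightarrow> v \<bullet> (A *v v) \<le> x \<bullet> (A *v x)"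
    by (meson continuous_attains_inf)
  define c where "c = v \<bullet> (A *v v)"
  have vS: "v \<in> S" and vv: "v \<bullet> v = 1" and v0: "v \<noteq> 0"
    using v by (auto simp: dot_square_norm)
  have low: "c * (x \<bullet> x) \<le> x \<bullet> (A *v x)" if "x \<in> S" for x
  proof (cases "x = 0")
    case False
    have "x /\<^sub>R norm x \<in> ?K"
      using that False S by (simp add: subspace_scale)
    from vmin[OF this] have "c \<le> (x \<bullet> (A *v x)) / (norm x)\<^sup>2"
      by (simp add: c_def matrix_vector_mult_scaleR power2_eq_square field_simps)
    then show ?thesis
      using False by (simp add: field_simps dot_square_norm)
  qed simp
  \<comment> \<open>The form \<open>x \<bullet> (A x - c x)\<close> is nonnegative on \<open>S\<close> and vanishes at \<open>v\<close>, so it is stationary there.\<close>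
  define h where "h = A *v v - c *\<^sub>R v"
  have hS: "h \<in> S"
    unfolding h_def using S vS inv by (intro subspace_diff subspace_scale)
  have symA: "x \<bullet> (A *v z) = (A *v x) \<bullet> z" for x z
    using inner_transpose_mult[of x A z] by (simp add: sym)
  define q where "q = h \<bullet> (A *v h) - c * (h \<bullet> h)"
  \<comment> \<open>Evaluate the lower bound at \<open>v + t *\<^sub>R h\<close>, which stays in
    \<open>S\<close>. The constant terms cancel by the choice of \<open>c\<close>, and the linear
    coefficient is twice \<open>h \<bullet> (A *v v - c *\<^sub>R v)\<close>, that is, twice
    \<open>h \<bullet> h\<close>.\<close>
  have quad: "0 \<le> 2 * t * (h \<bullet> h) + t\<^sup>2 * q" for t
  proof -
    have "c * ((v + t *\<^sub>R h) \<bullet> (v + t *\<^sub>R h)) \<le> (v + t *\<^sub>R h) \<bullet> (A *v (v + t *\<^sub>R h))"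
      using S vS hS by (intro low subspace_add subspace_scale)
    moreover have "v \<bullet> (A *v h) = h \<bullet> h + c * (v \<bullet> h)" "h \<bullet> (A *v v) = h \<bullet> h + c * (v \<bullet> h)"
      using symA[of v h] by (auto simp: h_def inner_commute algebra_simps inner_diff_left inner_diff_right)
    ultimately show ?thesis
      by (simp add: matrix_vector_right_distrib matrix_vector_mult_scaleR inner_add_left inner_add_right
          q_def vv c_def[symmetric] inner_commute[of h v] algebra_simps power2_eq_square)
  qed
  have "h = 0"
  proof (rule ccontr)
    assume "h \<noteq> 0"
    then have hh: "h \<bullet> h > 0" by simp
    \<comment> \<open>This step size gives \<open>t * \<bar>q\<bar> < h \<bullet> h\<close>, so at
      \<open>- t\<close> the linear term outweighs the quadratic one and the form would be
      negative.\<close>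
    define t where "t = (h \<bullet> h) / (\<bar>q\<bar> + 1)"
    have t: "t > 0" using hh by (simp add: t_def)
    have "t * q \<le> t * \<bar>q\<bar>" using t by simp
    also have "\<dots> < h \<bullet> h" using hh by (simp add: t_def field_simps)
    finally have "t * (t * q) < t * (h \<bullet> h)" using t by simp
    moreover have "t * (h \<bullet> h) > 0" using t hh by simp
    moreover have "0 \<le> - 2 * t * (h \<bullet> h) + t * (t * q)"
      using quad[of "- t"] by (simp add: power2_eq_square)
    ultimately show False by linarith
  qed
  then have "c \<in> eigenvalues_on S A"
    using vS v0 by (auto simp: eigenvalues_on_def h_def)
  then show thesis
    using low that by blast
qed

text \<open>Pairing the equation with \<open>w\<close> and applying Cauchy-Schwarz gives the bound,
  with \<open>c\<close> the least eigenvalue on \<open>S\<close>. One \<open>\<rho>\<close> serves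
  all vectors, so that a supremum over them stays below 1.\<close>

lemma resolvent_contraction:
  fixes A :: "real ^ 'a ^ 'a::finite"
  assumes sym: "transpose A = A" and S: "subspace S" and inv: "\<And>x. x \<in> S \<Longrightarrow> A *v x \<in> S"
    and pos: "\<And>\<mu>. \<mu> \<in> eigenvalues_on S A \<Longrightarrow> \<mu> > 0" and "\<alpha> > 0"
  obtains \<rho> where "0 \<le> \<rho>" "\<rho> < 1"
    "\<And>v w. w \<in> S \<Longrightarrow> A *v w + \<alpha> *\<^sub>R w = \<alpha> *\<^sub>R v \<Longrightarrow> norm w \<le> \<rho> * norm v"
\<comment> \<open>The zero subspace has no eigenvectors and hence no least eigenvalue; there
  \<open>w = 0\<close> and \<open>\<rho> = 0\<close> works.\<close>
proof (cases "S = {0}")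
  case True
  then show thesis
    using that[of 0] by simp
next
  case False
  obtain c where c: "c \<in> eigenvalues_on S A" and low: "\<And>x. x \<in> S \<Longrightarrow> c * (x \<bullet> x) \<le> x \<bullet> (A *v x)"
    using symmetric_min_eigenvalue_on[OF sym S inv False] by blast
  have "c > 0"
    using pos c by blast
  show thesis
  proof (rule that[of "\<alpha> / (\<alpha> + c)"])
    fix v w
    assume w: "w \<in> S" and eq: "A *v w + \<alpha> *\<^sub>R w = \<alpha> *\<^sub>R v"
    have "(\<alpha> + c) * (w \<bullet> w) \<le> w \<bullet> (A *v w + \<alpha> *\<^sub>R w)"
      using low[OF w] by (simp add: algebra_simps inner_add_right)
    also have "\<dots> \<le> \<alpha> * (norm w * norm v)"
      unfolding eq using norm_cauchy_schwarz[of w v] \<open>\<alpha> > 0\<close> by simp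
    finally have "norm w * ((\<alpha> + c) * norm w) \<le> norm w * (\<alpha> * norm v)"
      by (simp add: dot_square_norm power2_eq_square algebra_simps)
    then have "(\<alpha> + c) * norm w \<le> \<alpha> * norm v"
      using \<open>\<alpha> > 0\<close> by (cases "w = 0") auto
    then show "norm w \<le> \<alpha> / (\<alpha> + c) * norm v"
      using \<open>\<alpha> > 0\<close> \<open>c > 0\<close> by (simp add: field_simps)
  qed (use \<open>\<alpha> > 0\<close> \<open>c > 0\<close> in auto)
qed

text \<open>Commutation enters twice: it makes \<Sigma>\<Omega> symmetric, and it lets \<Omega> act
  last, so that \<Sigma>\<Omega> has its values in the range of \<open>transpose J\<close>, which
  lies in \<open>S\<close>. Thus \<Sigma>\<Omega> meets the requirements of the resolvent estimate
  on \<open>S\<close>.\<close>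

lemma gain_contraction:
  fixes J :: "real ^ 'a::finite ^ 'b::finite" and \<Sigma> :: "real ^ 'a ^ 'a" and Q :: "real ^ 'b ^ 'b"
  defines "\<Omega> \<equiv> transpose J ** matrix_inv Q ** J"
    and "S \<equiv> orthogonal_comp {v. J *v v = 0}"
  assumes \<Sigma>: "sym_pos_def \<Sigma>" and Q: "sym_pos_def Q" and "\<alpha> > 0"
    and comm: "\<Sigma> ** \<Omega> = \<Omega> ** \<Sigma>"
  obtains \<rho> where "0 \<le> \<rho>" "\<rho> < 1"
    "\<And>v. v \<in> S \<Longrightarrow>
      norm (v - (\<Sigma> ** transpose J ** matrix_inv (J ** \<Sigma> ** transpose J + \<alpha> *\<^sub>R Q)) *v (J *v v))
        \<le> \<rho> * norm v"
proof -
  let ?M = "J ** \<Sigma> ** transpose J + \<alpha> *\<^sub>R Q"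
  let ?A = "\<Sigma> ** \<Omega>"
  note Qinv = sym_pos_def_invertible[OF Q]
  note Minv = sym_pos_def_invertible[OF sym_pos_def_congruence_add[OF \<Sigma> Q \<open>\<alpha> > 0\<close>, of J]]
  have sS: "subspace S"
    unfolding S_def by (rule subspace_orthogonal_comp)
  have rangeS: "transpose J *v z \<in> S" for z
    by (simp add: S_def orthogonal_comp_def orthogonal_def inner_transpose_mult)
  have \<Omega>v: "\<Omega> *v x = transpose J *v (matrix_inv Q *v (J *v x))" for x
    by (simp add: \<Omega>_def matrix_vector_mul_assoc matrix_mul_assoc)
  have A\<Omega>: "?A *v x = \<Omega> *v (\<Sigma> *v x)" for x
    by (simp add: comm matrix_vector_mul_assoc)
  have AS: "?A *v x \<in> S" for x
    unfolding A\<Omega> \<Omega>v by (rule rangeS)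
  have "transpose \<Omega> = \<Omega>"
    by (simp add: \<Omega>_def matrix_transpose_mul transpose_transpose matrix_mul_assoc
        sym_pos_def_symmetric[OF sym_pos_def_matrix_inv[OF Q]])
  then have symA: "transpose ?A = ?A"
    by (simp add: matrix_transpose_mul sym_pos_def_symmetric[OF \<Sigma>] comm)
  have pos: "\<mu> > 0" if \<mu>: "\<mu> \<in> eigenvalues_on S ?A" for \<mu>
  proof -
    obtain v where v: "v \<in> S" "v \<noteq> 0" "\<Sigma> *v (\<Omega> *v v) = \<mu> *\<^sub>R v"
      using \<mu> by (auto simp: eigenvalues_on_def matrix_vector_mul_assoc)
    \<comment> \<open>A vector of \<open>S\<close> in the kernel of \<open>J\<close> is orthogonal
      to itself, hence zero.\<close>
    have "J *v v \<noteq> 0"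
      using v by (auto simp: S_def orthogonal_comp_def orthogonal_def)
    then have "v \<bullet> (\<Omega> *v v) > 0"
      using sym_pos_def_pos[OF sym_pos_def_matrix_inv[OF Q]] by (simp add: \<Omega>v inner_transpose_mult)
    moreover have "\<Omega> *v v = \<mu> *\<^sub>R (matrix_inv \<Sigma> *v v)"
      using matrix_inv_matrix_vector_mult[OF sym_pos_def_invertible[OF \<Sigma>], of "\<Omega> *v v"]
      by (simp add: v(3) matrix_vector_mult_scaleR)
    ultimately have "\<mu> * (v \<bullet> (matrix_inv \<Sigma> *v v)) > 0"
      by simp
    then show ?thesis
      using sym_pos_def_pos[OF sym_pos_def_matrix_inv[OF \<Sigma>] v(2)] by (simp add: zero_less_mult_iff)
  qed
  obtain \<rho> where \<rho>: "0 \<le> \<rho>" "\<rho> < 1"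
    "\<And>v w. w \<in> S \<Longrightarrow> ?A *v w + \<alpha> *\<^sub>R w = \<alpha> *\<^sub>R v \<Longrightarrow> norm w \<le> \<rho> * norm v"
    using resolvent_contraction[OF symA sS AS pos \<open>\<alpha> > 0\<close>] by metis
  show thesis
  proof (rule that[OF \<rho>(1,2)])
    fix v
    assume v: "v \<in> S"
    define z where "z = matrix_inv ?M *v (J *v v)"
    define w where "w = v - \<Sigma> *v (transpose J *v z)"
    have "?M *v z = J *v v"
      unfolding z_def by (rule matrix_vector_mult_matrix_inv[OF Minv])
    \<comment> \<open>Subtracting the congruence term from the equation for \<open>z\<close> leaves
      exactly the regularizing term. Then \<open>matrix_inv Q\<close> cancels \<open>Q\<close>, and
      \<Sigma>\<Omega> maps \<open>w\<close> to \<open>\<alpha> *\<^sub>R (v - w)\<close>.\<close>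
    then have Jw: "J *v w = \<alpha> *\<^sub>R (Q *v z)"
      by (simp add: w_def matrix_vector_mult_diff_distrib matrix_vector_mult_add_rdistrib
          matrix_vector_mul_assoc matrix_mul_assoc scaleR_matrix_vector_assoc[symmetric] algebra_simps)
    have "?A *v w = \<Sigma> *v (transpose J *v (\<alpha> *\<^sub>R z))"
      by (simp add: matrix_vector_mul_assoc[symmetric] \<Omega>v Jw matrix_vector_mult_scaleR
          matrix_inv_matrix_vector_mult[OF Qinv])
    then have eq: "?A *v w + \<alpha> *\<^sub>R w = \<alpha> *\<^sub>R v"
      by (simp add: w_def matrix_vector_mult_scaleR scaleR_diff_right)
    \<comment> \<open>Solved for \<open>w\<close>, the resolvent equation exhibits it as a
      combination of two elements of \<open>S\<close>.\<close>
    then have "w = v - (1 / \<alpha>) *\<^sub>R (?A *v w)"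
      using \<open>\<alpha> > 0\<close> by (simp add: vec_eq_iff field_simps)
    then have "w \<in> S"
      using v AS[of w] sS by (metis subspace_diff subspace_scale)
    from \<rho>(3)[OF this eq]
    show "norm (v - (\<Sigma> ** transpose J ** matrix_inv ?M) *v (J *v v)) \<le> \<rho> * norm v"
      by (simp add: w_def z_def matrix_vector_mul_assoc matrix_mul_assoc)
  qed
qed

subsection \<open>Differentiation at a zero of the defect\<close>

lemma norm_matrix_vector_mult_le:
  fixes A :: "real ^ 'n ^ 'm"
  shows "norm (A *v x) \<le> real CARD('m) * (norm A * norm x)"
proof -
  have "norm (A *v x) \<le> (\<Sum>i\<in>UNIV. \<bar>(A *v x) $ i\<bar>)"
    by (rule norm_le_l1_cart)
  also have "\<dots> \<le> (\<Sum>i\<in>(UNIV :: 'm set). norm A * norm x)"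
  proof (rule sum_mono)
    fix i
    have "\<bar>(A *v x) $ i\<bar> \<le> norm (A $ i) * norm x"
      by (simp add: matrix_vector_mul_component Cauchy_Schwarz_ineq2)
    also have "\<dots> \<le> norm A * norm x"
      by (intro mult_right_mono Finite_Cartesian_Product.norm_nth_le) simp
    finally show "\<bar>(A *v x) $ i\<bar> \<le> norm A * norm x" .
  qed
  finally show ?thesis by simp
qed

lemma bounded_bilinear_matrix_vector_mult:
  "bounded_bilinear ((*v) :: real ^ 'n ^ 'm \<Rightarrow> real ^ 'n \<Rightarrow> real ^ 'm)"
proof
  show "\<exists>K. \<forall>(A :: real ^ 'n ^ 'm) x. norm (A *v x) \<le> norm A * norm x * K"
    using norm_matrix_vector_mult_le by (metis mult.commute)
qed (simp_all add: algebra_simps scaleR_matrix_vector_assoc[symmetric])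

text \<open>Since \<open>g\<close> vanishes at \<open>u\<close>, it is of first order in
  \<open>w - u\<close>, and replacing \<open>A w\<close> by \<open>A u\<close> costs only o(|w -
  u|). Continuity of \<open>A\<close> therefore replaces differentiability, and the gain never has
  to be differentiated.\<close>

lemma has_derivative_continuous_mult_zero:
  fixes A :: "real ^ 'a \<Rightarrow> real ^ 'n ^ 'm" and g :: "real ^ 'a \<Rightarrow> real ^ 'n"
  assumes A: "isCont A u" and g: "(g has_derivative g') (at u)" and "g u = 0"
  shows "((\<lambda>w. A w *v g w) has_derivative (\<lambda>v. A u *v g' v)) (at u)"
proof -
  interpret mv: bounded_bilinear "(*v) :: real ^ 'n ^ 'm \<Rightarrow> real ^ 'n \<Rightarrow> real ^ 'm"
    by (rule bounded_bilinear_matrix_vector_mult)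
  interpret g': bounded_linear g'
    using g by (rule has_derivative_bounded_linear)
  have rem: "((\<lambda>w. (g w - g' (w - u)) /\<^sub>R norm (w - u)) \<longlongrightarrow> 0) (at u)"
    using g \<open>g u = 0\<close> by (simp add: has_derivative_at_within)
  have Au: "((\<lambda>w. A w - A u) \<longlongrightarrow> 0) (at u)"
    using A by (simp add: isCont_def LIM_zero)
  obtain K where K: "\<And>x. norm (g' x) \<le> norm x * K"
    using g'.bounded by blast
  \<comment> \<open>A null function times the bounded difference quotient of \<open>g'\<close>.\<close>
  have "((\<lambda>w. (A w - A u) *v (g' (w - u) /\<^sub>R norm (w - u))) \<longlongrightarrow> 0) (at u)"
    unfolding tendsto_Zfun_iff diff_zero
  proof (rule mv.Zfun_prod_Bfun)
    show "Zfun (\<lambda>w. A w - A u) (at u)"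
      using Au by (simp add: tendsto_Zfun_iff)
    show "Bfun (\<lambda>w. g' (w - u) /\<^sub>R norm (w - u)) (at u)"
    proof (rule BfunI[of _ K])
      have "norm (g' (w - u) /\<^sub>R norm (w - u)) \<le> K" if "w \<noteq> u" for w
        using K[of "w - u"] that by (simp add: divide_simps mult.commute)
      then show "\<forall>\<^sub>F w in at u. norm (g' (w - u) /\<^sub>R norm (w - u)) \<le> K"
        by (auto simp: eventually_at_filter)
    qed
  qed
  moreover have "((\<lambda>w. A w *v ((g w - g' (w - u)) /\<^sub>R norm (w - u))) \<longlongrightarrow> A u *v 0) (at u)"
    using A rem by (intro mv.tendsto) (simp_all add: isCont_def)
  ultimately have "((\<lambda>w. (A w - A u) *v (g' (w - u) /\<^sub>R norm (w - u))
      + A w *v ((g w - g' (w - u)) /\<^sub>R norm (w - u))) \<longlongrightarrow> 0 + A u *v 0) (at u)"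
    by (rule tendsto_add)
  \<comment> \<open>The remainder of the product splits into the change of \<open>A\<close> acting
    on the linear part of \<open>g\<close>, plus \<open>A w\<close> acting on the remainder of
    \<open>g\<close>.\<close>
  moreover have "(A w - A u) *v (g' (w - u) /\<^sub>R norm (w - u))
      + A w *v ((g w - g' (w - u)) /\<^sub>R norm (w - u))
      = (A w *v g w - A u *v g u - A u *v g' (w - u)) /\<^sub>R norm (w - u)" for w
    using \<open>g u = 0\<close>
    by (simp add: mv.diff_left mv.diff_right mv.scaleR_right scaleR_diff_right)
  moreover have "bounded_linear (\<lambda>v. A u *v g' v)"
    using mv.bounded_linear_right g'.bounded_linear_axioms by (rule bounded_linear_compose)
  ultimately show ?thesis
    by (simp add: has_derivative_at_within)
qed

lemma has_derivative_gain_step: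
  fixes g :: "real ^ 'a::finite \<Rightarrow> real ^ 'b::finite" and J :: "real ^ 'a \<Rightarrow> real ^ 'a ^ 'b"
  assumes \<Sigma>: "sym_pos_def \<Sigma>" and Q: "sym_pos_def Q" and "\<alpha> > 0"
    and g: "(g has_derivative (*v) (J u)) (at u)" and J: "isCont J u" and "g u = 0"
  shows "((\<lambda>w. w - (\<Sigma> ** transpose (J w)
              ** matrix_inv (J w ** \<Sigma> ** transpose (J w) + \<alpha> *\<^sub>R Q)) *v g w)
           has_derivative
          (\<lambda>v. v - (\<Sigma> ** transpose (J u)
              ** matrix_inv (J u ** \<Sigma> ** transpose (J u) + \<alpha> *\<^sub>R Q)) *v (J u *v v))) (at u)"
proof (intro has_derivative_diff has_derivative_ident has_derivative_continuous_mult_zero g \<open>g u = 0\<close>)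
  \<comment> \<open>Inversion is continuous here because the limit matrix is positive definite; all
    other operations are polynomial in the entries.\<close>
  show "isCont (\<lambda>w. \<Sigma> ** transpose (J w) ** matrix_inv (J w ** \<Sigma> ** transpose (J w) + \<alpha> *\<^sub>R Q)) u"
    using J unfolding isCont_def
    by (intro tendsto_matrix_mult tendsto_matrix_inv tendsto_transpose tendsto_add tendsto_const
        sym_pos_def_invertible sym_pos_def_congruence_add[OF \<Sigma> Q \<open>\<alpha> > 0\<close>])
qed

section \<open>Derivative and Jacobian of the defect map\<close>

lemma linear_block: "linear (\<lambda>u. block u n)"
  by (rule linearI) (simp_all add: block_def vec_eq_iff)

lemma bounded_linear_block: "bounded_linear (\<lambda>u. block u n)"
  using linear_block by (rule linear_conv_bounded_linear[THEN iffD1])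

lemma G_map_has_derivative:
  fixes F :: "nat \<Rightarrow> real ^ 'm::finite \<Rightarrow> real ^ 'm" and u :: "('n::finite, 'm) traj"
  assumes F: "\<And>n. n < CARD('n) \<Longrightarrow> (F n has_derivative F' n) (at (block u n))"
  shows "(G_map F has_derivative
      (\<lambda>v. \<chi> p. (block v (Suc (idx_nat (fst p))) - F' (idx_nat (fst p)) (block v (idx_nat (fst p)))) $ snd p))
      (at u)"
  unfolding has_derivative_componentwise_within[of "G_map F"]
proof
  fix b :: "('n, 'm) defect"
  assume "b \<in> Basis"
  then obtain p where b: "b = axis p 1"
    by (auto simp: Basis_vec_def)
  \<comment> \<open>Block rows are numbered from 0 to N - 1, the range in which \<open>F\<close> is
    assumed differentiable; \<open>Suc n\<close> is then at most N, a valid block of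
    \<open>u\<close>.\<close>
  have n: "idx_nat (fst p) < CARD('n)"
    using idx_nat[of "fst p"] by simp
  note blk = bounded_linear.has_derivative[OF bounded_linear_block has_derivative_ident]
  have "((\<lambda>w. (block w (Suc (idx_nat (fst p))) - F (idx_nat (fst p)) (block w (idx_nat (fst p)))) $ snd p)
      has_derivative
      (\<lambda>v. (block v (Suc (idx_nat (fst p))) - F' (idx_nat (fst p)) (block v (idx_nat (fst p)))) $ snd p))
      (at u)"
    by (intro bounded_linear.has_derivative[OF bounded_linear_vec_nth] has_derivative_diff blk
        has_derivative_compose[OF blk F[OF n]])
  then show "((\<lambda>w. G_map F w \<bullet> b) has_derivative
      (\<lambda>v. (\<chi> p. (block v (Suc (idx_nat (fst p))) - F' (idx_nat (fst p)) (block v (idx_nat (fst p)))) $ snd p) \<bullet> b))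
      (at u)"
    by (simp add: b G_map_def Let_def inner_axis)
qed

lemma
  fixes F :: "nat \<Rightarrow> real ^ 'm::finite \<Rightarrow> real ^ 'm" and u :: "('n::finite, 'm) traj"
  assumes "\<And>n. n < CARD('n) \<Longrightarrow> C3 (F n)"
  shows G_map_has_derivative_G_jac: "(G_map F has_derivative (*v) (G_jac F u)) (at u)"
    and isCont_G_jac: "isCont (G_jac F) u"
proof -
  \<comment> \<open>The first derivative is continuous because it is itself differentiable.\<close>
  have "\<exists>f1 :: real ^ 'm \<Rightarrow> (real ^ 'm) \<Rightarrow>\<^sub>L (real ^ 'm).
      (\<forall>x. (F n has_derivative blinfun_apply (f1 x)) (at x)) \<and> (\<forall>x. isCont f1 x)"
    if "n < CARD('n)" for n
    using assms[OF that] unfolding C3_def by (meson has_derivative_continuous)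
  then obtain f1 :: "nat \<Rightarrow> real ^ 'm \<Rightarrow> (real ^ 'm) \<Rightarrow>\<^sub>L (real ^ 'm)"
    where f1: "\<And>n x. n < CARD('n) \<Longrightarrow> (F n has_derivative blinfun_apply (f1 n x)) (at x)"
      and cont: "\<And>n x. n < CARD('n) \<Longrightarrow> isCont (f1 n) x"
    by metis
  have der: "(G_map F has_derivative (\<lambda>v. \<chi> p. (block v (Suc (idx_nat (fst p)))
      - f1 (idx_nat (fst p)) (block w (idx_nat (fst p))) (block v (idx_nat (fst p)))) $ snd p)) (at w)"
    for w :: "('n, 'm) traj"
    using f1 by (rule G_map_has_derivative)
  have diff: "G_map F differentiable (at w)" for w :: "('n, 'm) traj"
    using der by (rule differentiableI)
  show "(G_map F has_derivative (*v) (G_jac F u)) (at u)"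
    using diff[of u] unfolding jacobian_works G_jac_def .
  \<comment> \<open>By uniqueness of the derivative each Jacobian entry is explicit. Its dependence
    on \<open>w\<close> is only through \<open>f1\<close> at a block of \<open>w\<close>, which
    gives continuity entry by entry.\<close>
  have comp: "G_jac F w $ p $ q = (block (axis q 1) (Suc (idx_nat (fst p)))
      - f1 (idx_nat (fst p)) (block w (idx_nat (fst p))) (block (axis q 1) (idx_nat (fst p)))) $ snd p"
    for w :: "('n, 'm) traj" and p q
    unfolding G_jac_def jacobian_def frechet_derivative_at[OF der, symmetric] matrix_def by simp
  have "isCont (\<lambda>w. G_jac F w $ p $ q) u" for p q
  proof -
    have n: "idx_nat (fst p) < CARD('n)"
      using idx_nat[of "fst p"] by simp
    have "isCont (\<lambda>w :: ('n, 'm) traj. f1 (idx_nat (fst p)) (block w (idx_nat (fst p)))) u"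
      using linear_continuous_at[OF bounded_linear_block] cont[OF n] by (rule isCont_o2)
    then show ?thesis
      unfolding comp by (intro continuous_intros)
  qed
  then show "isCont (G_jac F) u"
    unfolding isCont_def by (intro vec_tendstoI) auto
qed

section \<open>Contraction on the normal spaces of the zero set\<close>

theorem lemma3p3:
  fixes F :: "nat \<Rightarrow> real ^ 'm::finite \<Rightarrow> real ^ 'm"
    and H :: "nat \<Rightarrow> real ^ 'm ^ 'd::finite"
    and R :: "nat \<Rightarrow> real ^ 'd ^ 'd"
    and W :: "nat \<Rightarrow> real ^ 'm ^ 'm"
    and Q :: "nat \<Rightarrow> real ^ 'm ^ 'm"
    and \<alpha> :: real
  assumes "CARD('d) \<le> CARD('m)"
    and "\<And>n. n < CARD('n::finite) \<Longrightarrow> C3 (F n)"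
    and "\<And>n. n \<le> CARD('n) \<Longrightarrow> sym_pos_def (R n)"
    and "\<And>n. n \<le> CARD('n) \<Longrightarrow> sym_pos_def (W n)"
    and "\<And>n. n \<in> {1..CARD('n)} \<Longrightarrow> sym_pos_def (Q n)"
    and "\<alpha> > 0"
    and "\<And>u :: ('n, 'm) traj. u \<in> zero_set F \<Longrightarrow>
           Sigma_mat H R W ** Omega_mat F Q u = Omega_mat F Q u ** Sigma_mat H R W"
    and "\<And>u :: ('n, 'm) traj. u \<in> zero_set F \<Longrightarrow>
           \<alpha> > 1 / 2 * lambda_max (normal_space_at F u) (Sigma_mat H R W ** Omega_mat F Q u)
                - lambda_min (normal_space_at F u) (Sigma_mat H R W ** Omega_mat F Q u)"
  shows "\<forall>u :: ('n, 'm) traj. u \<in> zero_set F \<longrightarrow>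
           onorm_on (normal_space_at F u) (frechet_derivative (phi_map F H R W Q \<alpha>) (at u)) < 1"
proof (intro allI impI)
  fix u :: "('n, 'm) traj"
  assume u: "u \<in> zero_set F"
  define \<Sigma> :: "real ^ ('n option idx \<times> 'm) ^ ('n option idx \<times> 'm)" where "\<Sigma> = Sigma_mat H R W"
  define Qm :: "real ^ ('n idx \<times> 'm) ^ ('n idx \<times> 'm)" where "Qm = Q_mat Q"
  \<comment> \<open>The blocks of \<Sigma> are indexed by \<open>'n option idx\<close>, of size N +
    1, so the strict bound there is \<open>n \<le> CARD('n)\<close>.\<close>
  have spd\<Sigma>: "sym_pos_def \<Sigma>"
    unfolding \<Sigma>_def using assms(3,4) by (intro sym_pos_def_Sigma_mat) simp_all
  \<comment> \<open>Block \<open>n < CARD('n)\<close> is \<open>Q (Suc n)\<close>, and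
    \<open>Suc n\<close> lies in \<open>{1..CARD('n)}\<close>.\<close>
  have spdQ: "sym_pos_def Qm"
    unfolding Qm_def Q_mat_def using assms(5) by (intro sym_pos_def_blockdiag) simp
  have comm: "\<Sigma> ** (transpose (G_jac F u) ** matrix_inv Qm ** G_jac F u)
      = transpose (G_jac F u) ** matrix_inv Qm ** G_jac F u ** \<Sigma>"
    using assms(7)[OF u] by (simp add: \<Sigma>_def Qm_def Omega_mat_def)
  define D where "D v = v - (\<Sigma> ** transpose (G_jac F u)
      ** matrix_inv (G_jac F u ** \<Sigma> ** transpose (G_jac F u) + \<alpha> *\<^sub>R Qm)) *v (G_jac F u *v v)" for v
  have "(phi_map F H R W Q \<alpha> has_derivative D) (at u)"
    using has_derivative_gain_step[OF spd\<Sigma> spdQ assms(6)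
        G_map_has_derivative_G_jac[OF assms(2)] isCont_G_jac[OF assms(2)]] u
    by (simp add: phi_map_def[abs_def] Let_def D_def[abs_def] \<Sigma>_def Qm_def zero_set_def)
  then have D: "frechet_derivative (phi_map F H R W Q \<alpha>) (at u) = D"
    by (rule frechet_derivative_at[symmetric])
  obtain \<rho> where \<rho>: "0 \<le> \<rho>" "\<rho> < 1" "\<And>v. v \<in> normal_space_at F u \<Longrightarrow> norm (D v) \<le> \<rho> * norm v"
    using gain_contraction[OF spd\<Sigma> spdQ assms(6) comm]
    unfolding normal_space_at_def tangent_space_at_def D_def by metis
  \<comment> \<open>The uniform constant bounds every quotient; at \<open>v = 0\<close> the quotient
    is 0 by the convention for division, which is where \<open>0 \<le> \<rho>\<close>
    enters.\<close>
  have "onorm_on (normal_space_at F u) D \<le> \<rho>"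
    unfolding onorm_on_def
  proof (rule cSUP_least)
    show "normal_space_at F u \<noteq> {}"
      unfolding normal_space_at_def using subspace_0[OF subspace_orthogonal_comp] by blast
    show "norm (D v) / norm v \<le> \<rho>" if "v \<in> normal_space_at F u" for v
      using \<rho>(1) \<rho>(3)[OF that] by (cases "v = 0") (simp_all add: divide_simps)
  qed
  then show "onorm_on (normal_space_at F u) (frechet_derivative (phi_map F H R W Q \<alpha>) (at u)) < 1"
    unfolding D using \<rho>(2) by simp
qed

end
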